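(* Let $G$ be a connected graph on $q\ge 2$ vertices. For every $n\in\mathbb{N}$, the metric dimension $m(G,n)$ of $G^{\square n}$ satisfies \[ m(G,n) \ge \left(2 - O\!\left(\frac{\log\log n}{\log n}\right)\right)\frac{n}{\log_q n}. \]
   Context: A set of vertices $S$ resolves a graph $H$ if every vertex of $H$ is uniquely determined by its vector of distances to the vertices in $S$; the metric dimension of $H$ is the minimum cardinality of a resolving set. The Cartesian product of graphs $G_1,\dots,G_n$ has vertex set $V(G_1)\times\dots\times V(G_n)$, with $(u_1,\dots,u_n)$ and $(v_1,\dots,v_n)$ adjacent iff there is $j$ with $u_i=v_i$ for all $i\ne j$ and $u_j$ adjacent to $v_j$ in $G_j$. $G^{\square n}$ denotes the Cartesian product of $n$ copies of $G$, and $m(G,n)$ its metric dimension. The $O(\cdot)$ term is as $n\to\infty$ with $G$ fixed. *)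

theory Defs
  imports
    "Graph_Theory.Graph_Theory"
    "HOL-Library.FuncSet"
    "HOL-Library.Landau_Symbols"
begin

text \<open>
  Finite simple graphs are rendered by the locale \<^locale>\<open>pair_graph\<close>: finite, symmetric, loop-free
  digraphs whose arcs are ordered pairs, so that every edge is represented by two opposite arcs.
\<close>

text \<open>With unit weights the cost of a walk is its length; the value is infinite
  if the vertices lie in different components.\<close>

definition graph_dist :: "'a pair_pre_digraph \<Rightarrow> 'a \<Rightarrow> 'a \<Rightarrow> ereal" where
  "graph_dist H u v = wf_digraph.\<mu> (with_proj H) (\<lambda>_. 1) u v"

definition resolves :: "'a set \<Rightarrow> 'a pair_pre_digraph \<Rightarrow> bool" where
  "resolves S H \<longleftrightarrow> S \<subseteq> pverts H \<and>
     (\<forall>u\<in>pverts H. \<forall>v\<in>pverts H. (\<forall>s\<in>S. graph_dist H u s = graph_dist H v s) \<longrightarrow> u = v)"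

text \<open>Intended for finite graphs, where the set of all vertices resolves,
  so that the minimum is over a nonempty set.\<close>

definition metric_dimension :: "'a pair_pre_digraph \<Rightarrow> nat" where
  "metric_dimension H = (LEAST k. \<exists>S. finite S \<and> resolves S H \<and> card S = k)"

text \<open>Tuples indexed by \<open>I\<close> are the extensional functions on \<open>I\<close>.\<close>

definition cartesian_product :: "'i set \<Rightarrow> ('i \<Rightarrow> 'a pair_pre_digraph) \<Rightarrow> ('i \<Rightarrow> 'a) pair_pre_digraph" where
  "cartesian_product I G =
     \<lparr> pverts = (\<Pi>\<^sub>E i\<in>I. pverts (G i)),
       parcs = {(u, v). u \<in> (\<Pi>\<^sub>E i\<in>I. pverts (G i)) \<and> v \<in> (\<Pi>\<^sub>E i\<in>I. pverts (G i)) \<and>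
                  (\<exists>j\<in>I. (\<forall>i\<in>I - {j}. u i = v i) \<and> (u j, v j) \<in> parcs (G j))} \<rparr>"

definition cartesian_power :: "'a pair_pre_digraph \<Rightarrow> nat \<Rightarrow> (nat \<Rightarrow> 'a) pair_pre_digraph" where
  "cartesian_power G n = cartesian_product {..<n} (\<lambda>_. G)"

lemma pair_graph_cartesian_product:
  assumes "finite I" and G: "\<And>i. i \<in> I \<Longrightarrow> pair_graph (G i)"
  shows "pair_graph (cartesian_product I G)"
proof -
  let ?H = "cartesian_product I G"
  have fin: "finite (pverts (G i))" if "i \<in> I" for i
    using G[OF that] by (simp add: pair_graph_def pair_digraph_def pair_fin_digraph_def
        pair_fin_digraph_axioms_def)
  have sym: "(y, x) \<in> parcs (G i)" if "i \<in> I" "(x, y) \<in> parcs (G i)" for i x y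
    using G[OF that(1)] that(2)
    by (auto simp: pair_graph_def pair_pseudo_graph_def pair_sym_digraph_def
        pair_sym_digraph_axioms_def symmetric_def dest: symD)
  have irr: "(x, x) \<notin> parcs (G i)" if "i \<in> I" for i x
    using G[OF that] by (force simp: pair_graph_def pair_digraph_def pair_loopfree_digraph_def
        pair_loopfree_digraph_axioms_def)
  have V: "finite (pverts ?H)"
    using \<open>finite I\<close> fin by (auto simp: cartesian_product_def intro!: finite_PiE)
  have "parcs ?H \<subseteq> pverts ?H \<times> pverts ?H"
    by (auto simp: cartesian_product_def)
  then have A: "finite (parcs ?H)"
    using V finite_subset by blast
  have S: "sym (parcs ?H)"
    unfolding sym_def cartesian_product_def by (auto intro!: sym) (metis Diff_iff sym)
  show ?thesis
    using V A S by unfold_locales (auto simp: cartesian_product_def symmetric_def irr)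
qed

end

theory Submission
  imports Defs
begin

text \<open>
  Let \<open>S\<close> be a resolving set of the \<open>n\<close>-th power with \<open>k\<close> elements. For a uniformly random vertex
  \<open>u\<close> the distance \<open>d(u, s)\<close> is a sum of \<open>n\<close> independent bounded terms, so it deviates from its mean
  \<open>\<mu> s\<close> by \<open>O(\<surd>n)\<close> on average. By Jensen's inequality the sum over all \<open>u\<close> of the weights
  \<open>exp (- (\<Sum>s\<in>S. \<bar>d(u, s) - \<mu> s\<bar> / \<surd>n))\<close> is therefore at least \<open>q ^ n * exp (- O(k))\<close>. Since the
  distance vectors are pairwise distinct, the same sum is at most a product over \<open>S\<close> of one-dimensional
  sums of the form \<open>\<Sum>a. exp (- \<bar>a - \<mu> s\<bar> / \<surd>n) = O(\<surd>n)\<close>. Hence \<open>q ^ n \<le> (C * \<surd>n) ^ k\<close>, and taking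
  logarithms gives the bound, even with error term \<open>O(1 / ln n)\<close>.
\<close>

section \<open>Distances in Cartesian products\<close>

text \<open>A potential certifies the distance: by \<open>step\<close> no walk to \<open>s\<close>
  is shorter than \<open>f\<close>, and by \<open>desc\<close> a greedy descent, which can only stop
  at \<open>s\<close>, attains it. This replaces direct work with the infimum over walks.\<close>

lemma graph_dist_eqI:
  fixes f :: "'a \<Rightarrow> nat"
  assumes wf: "pair_wf_digraph H"
    and u: "u \<in> pverts H"
    and zero: "f s = 0"
    and step: "\<And>x y. (x, y) \<in> parcs H \<Longrightarrow> f x \<le> Suc (f y)"
    and desc: "\<And>x. x \<in> pverts H \<Longrightarrow> x \<noteq> s \<Longrightarrow> \<exists>y. (x, y) \<in> parcs H \<and> Suc (f y) = f x"
  shows "graph_dist H u s = ereal (real (f u))"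
proof -
  interpret pair_wf_digraph H by (rule wf)
  have cost: "awalk_cost (\<lambda>_. 1) p = real (length p)" for p
    by (induction p) auto
  have lower: "f x \<le> length p" if "awalk x p s" for x p
    using that
  proof (induction p arbitrary: x)
    case Nil
    then show ?case by (simp add: awalk_Nil_iff zero)
  next
    case (Cons e p)
    then have "awalk (snd e) p s" "(x, snd e) \<in> parcs H"
      by (auto simp: awalk_Cons_iff)
    with Cons.IH step[of x "snd e"] show ?case by fastforce
  qed
  have ex: "\<exists>p. awalk x p s \<and> length p = f x" if "x \<in> pverts H" for x
    using that
  proof (induction "f x" arbitrary: x rule: less_induct)
    case less
    show ?case
    proof (cases "x = s")
      case True
      with less.prems show ?thesis
        by (intro exI[of _ "[]"]) (simp add: awalk_Nil_iff zero)
    next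
      case False
      with desc less.prems obtain y where y: "(x, y) \<in> parcs H" "Suc (f y) = f x" by blast
      then obtain p where "awalk y p s" "length p = f y"
        using less.hyps[of y] in_arcsD2 by auto
      with y show ?thesis
        by (intro exI[of _ "(x, y) # p"]) (simp add: awalk_Cons_iff)
    qed
  qed
  obtain p where p: "awalk u p s" "length p = f u" using ex[OF u] by blast
  show ?thesis
    unfolding graph_dist_def \<mu>_def
  proof (rule antisym)
    show "(INF p\<in>{p. awalk u p s}. ereal (awalk_cost (\<lambda>_. 1) p)) \<le> ereal (real (f u))"
      using p by (intro INF_lower2[of p]) (auto simp: cost)
    show "ereal (real (f u)) \<le> (INF p\<in>{p. awalk u p s}. ereal (awalk_cost (\<lambda>_. 1) p))"
      by (rule INF_greatest) (auto simp: cost lower)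
  qed
qed

text \<open>The distance within one factor, taken in \<open>nat\<close> so that coordinates can be
  summed and bounded without \<open>ereal\<close>. It is meaningful only when \<open>y\<close> is
  reachable from \<open>x\<close>.\<close>

definition rel_dist :: "'a rel \<Rightarrow> 'a \<Rightarrow> 'a \<Rightarrow> nat" where
  "rel_dist R x y = (LEAST k. (x, y) \<in> R ^^ k)"

lemma rel_dist_self [simp]: "rel_dist R x x = 0"
  unfolding rel_dist_def by (rule Least_equality) auto

lemma rel_dist_le: "(x, y) \<in> R ^^ k \<Longrightarrow> rel_dist R x y \<le> k"
  unfolding rel_dist_def by (rule Least_le)

lemma rel_dist_relpow: "(x, y) \<in> R\<^sup>* \<Longrightarrow> (x, y) \<in> R ^^ rel_dist R x y"
  unfolding rel_dist_def by (metis LeastI rtrancl_imp_relpow)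

lemma rel_dist_step:
  assumes "(x, y) \<in> R" "(y, t) \<in> R\<^sup>*"
  shows "rel_dist R x t \<le> Suc (rel_dist R y t)"
  using assms by (intro rel_dist_le relpow_Suc_I2[of x y] rel_dist_relpow)

lemma rel_dist_descend:
  assumes "(x, t) \<in> R\<^sup>*" "x \<noteq> t"
  obtains y where "(x, y) \<in> R" "Suc (rel_dist R y t) = rel_dist R x t"
proof -
  have pow: "(x, t) \<in> R ^^ rel_dist R x t" by (rule rel_dist_relpow[OF assms(1)])
  with assms(2) obtain k where k: "rel_dist R x t = Suc k"
    by (cases "rel_dist R x t") auto
  with pow obtain y where y: "(x, y) \<in> R" "(y, t) \<in> R ^^ k"
    by (metis relpow_Suc_D2)
  then have "rel_dist R x t \<le> Suc (rel_dist R y t)"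
    by (meson rel_dist_step relpow_imp_rtrancl)
  with k y rel_dist_le[OF y(2)] that show thesis by simp
qed

text \<open>The coordinatewise sum is a potential for \<open>graph_dist_eqI\<close>: an arc changes
  a single coordinate, and a tuple other than \<open>s\<close> has a coordinate that can move one
  step closer to its target.\<close>

lemma graph_dist_cartesian_product:
  assumes I: "finite I"
    and G: "\<And>i. i \<in> I \<Longrightarrow> pair_graph (G i)"
    and conn: "\<And>i x y. i \<in> I \<Longrightarrow> x \<in> pverts (G i) \<Longrightarrow> y \<in> pverts (G i) \<Longrightarrow> (x, y) \<in> (parcs (G i))\<^sup>*"
    and u: "u \<in> (\<Pi>\<^sub>E i\<in>I. pverts (G i))" and s: "s \<in> (\<Pi>\<^sub>E i\<in>I. pverts (G i))"
  shows "graph_dist (cartesian_product I G) u s =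
           ereal (real (\<Sum>i\<in>I. rel_dist (parcs (G i)) (u i) (s i)))"
proof (rule graph_dist_eqI)
  let ?H = "cartesian_product I G"
  let ?f = "\<lambda>u. \<Sum>i\<in>I. rel_dist (parcs (G i)) (u i) (s i)"
  show "pair_wf_digraph ?H"
    by (rule pair_wf_digraph.intro) (auto simp: cartesian_product_def)
  show "u \<in> pverts ?H" using u by (simp add: cartesian_product_def)
  show "?f s = 0" by simp
  have split: "?f x = rel_dist (parcs (G j)) (x j) (s j) + (\<Sum>i\<in>I-{j}. rel_dist (parcs (G i)) (x i) (s i))"
    if "j \<in> I" for x j
    using sum.remove[OF I that] .
  show "?f x \<le> Suc (?f y)" if "(x, y) \<in> parcs ?H" for x y
  proof -
    from that obtain j where j: "j \<in> I" "\<forall>i\<in>I - {j}. x i = y i" "(x j, y j) \<in> parcs (G j)"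
      and y: "y \<in> (\<Pi>\<^sub>E i\<in>I. pverts (G i))"
      by (auto simp: cartesian_product_def)
    have "(y j, s j) \<in> (parcs (G j))\<^sup>*"
      using conn[OF j(1)] y s j(1) by (auto dest: PiE_mem)
    from rel_dist_step[OF j(3) this] j(2) show ?thesis
      unfolding split[OF j(1)] by simp
  qed
  show "\<exists>y. (x, y) \<in> parcs ?H \<and> Suc (?f y) = ?f x" if "x \<in> pverts ?H" "x \<noteq> s" for x
  proof -
    have x: "x \<in> (\<Pi>\<^sub>E i\<in>I. pverts (G i))" using that by (simp add: cartesian_product_def)
    with s that obtain j where j: "j \<in> I" "x j \<noteq> s j" by (metis PiE_ext)
    interpret Gj: pair_graph "G j" by (rule G[OF j(1)])
    have "(x j, s j) \<in> (parcs (G j))\<^sup>*"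
      using conn[OF j(1)] x s j(1) by (auto dest: PiE_mem)
    from rel_dist_descend[OF this j(2)] obtain b
      where b: "(x j, b) \<in> parcs (G j)" "Suc (rel_dist (parcs (G j)) b (s j)) = rel_dist (parcs (G j)) (x j) (s j)" .
    let ?y = "x(j := b)"
    have "?y \<in> (\<Pi>\<^sub>E i\<in>I. pverts (G i))"
      using x j b Gj.in_arcsD2[OF b(1)] by (auto simp: PiE_iff extensional_def)
    then have "(x, ?y) \<in> parcs ?H"
      using x j b by (auto simp: cartesian_product_def)
    moreover have "Suc (?f ?y) = ?f x"
      unfolding split[OF j(1)] using b(2) by simp
    ultimately show ?thesis by blast
  qed
qed

text \<open>The \<open>LEAST\<close> is attained once some finite resolving set exists. The full
  vertex set is one, because the distances to \<open>v\<close> itself already separate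
  \<open>u\<close> from \<open>v\<close>.\<close>

lemma metric_dimension_witness:
  assumes "finite (pverts H)"
    and "\<And>u v. u \<in> pverts H \<Longrightarrow> v \<in> pverts H \<Longrightarrow> graph_dist H u v = graph_dist H v v \<Longrightarrow> u = v"
  obtains S where "finite S" "resolves S H" "card S = metric_dimension H"
proof -
  have "resolves (pverts H) H"
    using assms(2) by (auto simp: resolves_def)
  then have "\<exists>k S. finite S \<and> resolves S H \<and> card S = k"
    using assms(1) by blast
  from LeastI_ex[OF this] that show thesis
    unfolding metric_dimension_def by blast
qed

section \<open>A counting bound for sums of independent coordinates\<close>

lemma sum_PiE_insert:
  assumes "x \<notin> F"
  shows "(\<Sum>u\<in>Pi\<^sub>E (insert x F) T. h u) = (\<Sum>a\<in>T x. \<Sum>g\<in>Pi\<^sub>E F T. h (g(x := a)))"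
  unfolding PiE_insert_eq
  by (subst sum.reindex[OF inj_combinator[OF assms]]) (simp add: sum.cartesian_product case_prod_unfold)

text \<open>Additivity of variance for independent centred variables, with sums over tuples in place
  of expectations.\<close>

lemma sum_square_PiE_le:
  fixes f :: "'i \<Rightarrow> 'a \<Rightarrow> real" and B :: real
  assumes "finite I" and V: "finite V"
    and "\<And>i. i \<in> I \<Longrightarrow> (\<Sum>a\<in>V. f i a) = 0"
    and "\<And>i a. i \<in> I \<Longrightarrow> a \<in> V \<Longrightarrow> \<bar>f i a\<bar> \<le> B"
  shows "(\<Sum>u\<in>I \<rightarrow>\<^sub>E V. (\<Sum>i\<in>I. f i (u i))\<^sup>2) \<le> card V ^ card I * (card I * B\<^sup>2)"
  using assms(1,3,4)
proof (induction I rule: finite_induct)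
  case empty
  then show ?case by simp
next
  case (insert x F)
  let ?h = "\<lambda>g. \<Sum>i\<in>F. f i (g i)"
  let ?P = "F \<rightarrow>\<^sub>E V"
  have upd: "(\<Sum>i\<in>insert x F. f i ((g(x := a)) i)) = f x a + ?h g" for g a
  proof -
    have "(\<Sum>i\<in>F. f i ((g(x := a)) i)) = ?h g"
      using insert.hyps by (intro sum.cong) auto
    then show ?thesis using insert.hyps by simp
  qed
  have "(\<Sum>u\<in>insert x F \<rightarrow>\<^sub>E V. (\<Sum>i\<in>insert x F. f i (u i))\<^sup>2) = (\<Sum>a\<in>V. \<Sum>g\<in>?P. (f x a + ?h g)\<^sup>2)"
    unfolding sum_PiE_insert[OF insert.hyps(2)] upd ..
  also have "\<dots> = (\<Sum>a\<in>V. card ?P * (f x a)\<^sup>2 + 2 * f x a * (\<Sum>g\<in>?P. ?h g) + (\<Sum>g\<in>?P. (?h g)\<^sup>2))"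
    by (simp add: power2_sum sum.distrib sum_distrib_left mult.assoc add_ac)
  also have "\<dots> = card ?P * (\<Sum>a\<in>V. (f x a)\<^sup>2) + 2 * (\<Sum>a\<in>V. f x a) * (\<Sum>g\<in>?P. ?h g)
      + card V * (\<Sum>g\<in>?P. (?h g)\<^sup>2)"
    unfolding sum.distrib sum_constant
    by (simp flip: sum_distrib_left sum_distrib_right)
  \<comment> \<open>The cross term vanishes because \<open>f x\<close> sums to zero over
    \<open>V\<close>.\<close>
  also have "\<dots> = card V ^ card F * (\<Sum>a\<in>V. (f x a)\<^sup>2) + card V * (\<Sum>g\<in>?P. (?h g)\<^sup>2)"
    using insert.prems(1)[of x] insert.hyps by (simp add: card_funcsetE)
  also have "\<dots> \<le> card V ^ card F * (card V * B\<^sup>2) + card V * (card V ^ card F * (card F * B\<^sup>2))"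
  proof (intro add_mono mult_left_mono)
    have "(f x a)\<^sup>2 \<le> B\<^sup>2" if "a \<in> V" for a
      using insert.prems(2)[of x a] that by (simp add: abs_le_square_iff[symmetric])
    then show "(\<Sum>a\<in>V. (f x a)\<^sup>2) \<le> card V * B\<^sup>2"
      using sum_mono[of V "\<lambda>a. (f x a)\<^sup>2" "\<lambda>_. B\<^sup>2"] by simp
    show "(\<Sum>g\<in>?P. (?h g)\<^sup>2) \<le> card V ^ card F * (card F * B\<^sup>2)"
      using insert.IH insert.prems by simp
  qed auto
  also have "\<dots> = card V ^ card (insert x F) * (card (insert x F) * B\<^sup>2)"
    using insert.hyps by (simp add: algebra_simps)
  finally show ?case .
qed

text \<open>Comparison with a two-sided geometric series of ratio \<open>exp (- x)\<close>. Each of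
  three crude estimates costs a factor \<open>exp 1\<close>: the geometric sum, the two sides, and
  rounding \<mu> to an integer.\<close>

lemma sum_exp_abs_le:
  fixes x \<mu> :: real
  assumes x: "0 < x" "x \<le> 1" and A: "finite A"
  shows "(\<Sum>a\<in>A. exp (- (x * \<bar>real a - \<mu>\<bar>))) \<le> exp 3 / x"
proof -
  define m where "m = \<lfloor>\<mu>\<rfloor>"
  define r where "r = exp (- x)"
  have r: "0 < r" "r < 1" using x by (auto simp: r_def)
  have geo: "(\<Sum>k\<in>K. r ^ k) \<le> exp 1 / x" if "finite K" for K :: "nat set"
  proof -
    have "(\<Sum>k\<in>K. r ^ k) \<le> (\<Sum>k. r ^ k)"
      using that r by (intro sum_le_suminf summable_geometric) auto
    also have "\<dots> = 1 / (1 - r)" using r by (intro suminf_geometric) auto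
    also have "\<dots> \<le> exp 1 / x"
    proof -
      have "x \<le> exp x - 1" using exp_ge_add_one_self[of x] by linarith
      also have "\<dots> = exp x * (1 - r)" by (simp add: r_def algebra_simps exp_minus_inverse)
      also have "\<dots> \<le> exp 1 * (1 - r)" using r x by (intro mult_right_mono) auto
      finally show ?thesis using r x by (simp add: field_simps)
    qed
    finally show ?thesis .
  qed
  have pointwise: "exp (- (x * \<bar>real a - \<mu>\<bar>)) \<le> exp 1 * r ^ nat \<bar>int a - m\<bar>" for a
  proof -
    have "of_int m \<le> \<mu>" "\<mu> < of_int m + 1" by (auto simp: m_def)
    then have "\<bar>real a - of_int m\<bar> - 1 \<le> \<bar>real a - \<mu>\<bar>" by linarith
    moreover have "real (nat \<bar>int a - m\<bar>) = \<bar>real a - of_int m\<bar>" by simp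
    ultimately have "real (nat \<bar>int a - m\<bar>) - 1 \<le> \<bar>real a - \<mu>\<bar>" by simp
    then have "x * (real (nat \<bar>int a - m\<bar>) - 1) \<le> x * \<bar>real a - \<mu>\<bar>"
      using x by (intro mult_left_mono) auto
    then have "- (x * \<bar>real a - \<mu>\<bar>) \<le> 1 + real (nat \<bar>int a - m\<bar>) * (- x)"
      using x by (simp add: algebra_simps)
    then show ?thesis
      unfolding r_def exp_of_nat_mult[symmetric] exp_add[symmetric] by simp
  qed
  \<comment> \<open>On either side of \<open>m\<close> each distance to \<open>m\<close> occurs at
    most once, so each half of \<open>A\<close> is bounded by one geometric series.\<close>
  have inj: "inj_on (\<lambda>a. nat \<bar>int a - m\<bar>) {a \<in> A. int a \<ge> m}"
    "inj_on (\<lambda>a. nat \<bar>int a - m\<bar>) {a \<in> A. \<not> int a \<ge> m}"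
    by (auto simp: inj_on_def)
  have "(\<Sum>a\<in>A. r ^ nat \<bar>int a - m\<bar>)
      = (\<Sum>a\<in>{a \<in> A. int a \<ge> m}. r ^ nat \<bar>int a - m\<bar>) + (\<Sum>a\<in>{a \<in> A. \<not> int a \<ge> m}. r ^ nat \<bar>int a - m\<bar>)"
    using A by (subst sum.union_disjoint[symmetric]) (auto intro!: sum.cong)
  also have "\<dots> \<le> exp 1 / x + exp 1 / x"
    using A inj[THEN sum.reindex, of "\<lambda>k. r ^ k"]
      geo[of "(\<lambda>a. nat \<bar>int a - m\<bar>) ` {a \<in> A. int a \<ge> m}"]
      geo[of "(\<lambda>a. nat \<bar>int a - m\<bar>) ` {a \<in> A. \<not> int a \<ge> m}"]
    by (auto simp: o_def)
  also have "\<dots> = 2 * (exp 1 / x)" by simp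
  also have "\<dots> \<le> exp 1 * (exp 1 / x)"
    using x exp_ge_add_one_self[of 1] by (intro mult_right_mono) auto
  finally have two: "(\<Sum>a\<in>A. r ^ nat \<bar>int a - m\<bar>) \<le> exp 1 * (exp 1 / x)" .
  have "(\<Sum>a\<in>A. exp (- (x * \<bar>real a - \<mu>\<bar>))) \<le> exp 1 * (\<Sum>a\<in>A. r ^ nat \<bar>int a - m\<bar>)"
    unfolding sum_distrib_left by (intro sum_mono pointwise)
  also have "\<dots> \<le> exp 1 * (exp 1 * (exp 1 / x))"
    using two by (intro mult_left_mono) auto
  also have "\<dots> = exp 3 / x" by (simp add: exp_add[symmetric])
  finally show ?thesis .
qed

text \<open>Jensen's inequality for \<open>exp (- t)\<close>, proved by summing its tangent line at
  \<open>m\<close>; an upper bound on the mean suffices since that line is decreasing.\<close>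

lemma sum_exp_ge:
  fixes g :: "'a \<Rightarrow> real" and m :: real
  assumes "(\<Sum>u\<in>P. g u) \<le> card P * m"
  shows "card P * exp (- m) \<le> (\<Sum>u\<in>P. exp (- g u))"
proof -
  have "exp (- m) * (1 + m - g u) \<le> exp (- g u)" for u
  proof -
    have "exp (- m) * (1 + (m - g u)) \<le> exp (- m) * exp (m - g u)"
      by (intro mult_left_mono exp_ge_add_one_self) auto
    also have "\<dots> = exp (- g u)" by (simp add: exp_add[symmetric])
    finally show ?thesis by (simp add: algebra_simps)
  qed
  then have "(\<Sum>u\<in>P. exp (- m) * (1 + m - g u)) \<le> (\<Sum>u\<in>P. exp (- g u))"
    by (rule sum_mono)
  moreover have "(\<Sum>u\<in>P. exp (- m) * (1 + m - g u)) = exp (- m) * (card P * (1 + m) - (\<Sum>u\<in>P. g u))"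
    by (simp add: sum_distrib_left[symmetric] sum_subtractf)
  moreover have "exp (- m) * card P \<le> exp (- m) * (card P * (1 + m) - (\<Sum>u\<in>P. g u))"
    using assms by (intro mult_left_mono) (auto simp: algebra_simps)
  ultimately show ?thesis by (simp only: mult.commute[of "real (card P)" "exp (- m)"])
qed

text \<open>The weights \<open>exp (- g u)\<close> are summed in two ways: concentration of each
  statistic bounds the sum from below, joint injectivity of the statistics bounds it from
  above.\<close>

lemma card_power_le_of_inj_sums:
  fixes c :: "'s \<Rightarrow> 'i \<Rightarrow> 'a \<Rightarrow> nat"
  assumes I: "finite I" "I \<noteq> {}" and V: "finite V" "V \<noteq> {}" and S: "finite S"
    and bound: "\<And>s i a. s \<in> S \<Longrightarrow> i \<in> I \<Longrightarrow> a \<in> V \<Longrightarrow> c s i a \<le> D"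
    and inj: "inj_on (\<lambda>u. \<lambda>s\<in>S. \<Sum>i\<in>I. c s i (u i)) (I \<rightarrow>\<^sub>E V)"
  shows "real (card V) ^ card I \<le> (exp (3 + (1 + (real D)\<^sup>2) / 2) * sqrt (card I)) ^ card S"
proof -
  define n where "n = card I"
  \<comment> \<open>The inverse of the typical deviation scale, so that scaled deviations have
    bounded mean.\<close>
  define x where "x = 1 / sqrt n"
  define P where "P = I \<rightarrow>\<^sub>E V"
  define avg where "avg s i = (\<Sum>a\<in>V. real (c s i a)) / card V" for s i
  define \<mu> where "\<mu> s = (\<Sum>i\<in>I. avg s i)" for s
  define d where "d s u = (\<Sum>i\<in>I. c s i (u i))" for s u
  \<comment> \<open>Bounds the mean scaled deviation \<open>t\<close>:
    \<open>t \<le> (1 + t\<^sup>2) / 2\<close>, and the mean of \<open>t\<^sup>2\<close> is at most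
    \<open>D\<^sup>2\<close>.\<close>
  define m where "m = (1 + (real D)\<^sup>2) / 2"
  have n: "n \<ge> 1" using I by (simp add: n_def Suc_le_eq card_gt_0_iff)
  then have x: "0 < x" "x \<le> 1" "x\<^sup>2 = 1 / n" by (auto simp: x_def power_divide)
  have V0: "card V > 0" using V by (simp add: card_gt_0_iff)
  have cardP: "real (card P) = real (card V) ^ n" using I by (simp add: P_def n_def card_funcsetE)
  have finP: "finite P" using I V by (simp add: P_def finite_PiE)
  have var: "(\<Sum>u\<in>P. (real (d s u) - \<mu> s)\<^sup>2) \<le> card P * (n * (real D)\<^sup>2)" if s: "s \<in> S" for s
  proof -
    have "(\<Sum>u\<in>P. (\<Sum>i\<in>I. real (c s i (u i)) - avg s i)\<^sup>2) \<le> real (card V ^ card I) * (card I * (real D)\<^sup>2)"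
      unfolding P_def
    proof (rule sum_square_PiE_le[OF I(1) V(1), THEN order_trans])
      show "(\<Sum>a\<in>V. real (c s i a) - avg s i) = 0" for i
        using V0 by (simp add: sum_subtractf avg_def)
      show "\<bar>real (c s i a) - avg s i\<bar> \<le> real D" if "i \<in> I" "a \<in> V" for i a
      proof -
        have "(\<Sum>a\<in>V. real (c s i a)) \<le> (\<Sum>a\<in>V. real D)"
          using bound[OF s] that by (intro sum_mono) auto
        then have "avg s i \<le> D" using V0 by (simp add: avg_def field_simps)
        moreover have "0 \<le> avg s i" by (simp add: avg_def sum_nonneg)
        moreover have "real (c s i a) \<le> D" using bound[OF s] that by simp
        ultimately show ?thesis by linarith
      qed
    qed simp
    then show ?thesis using cardP by (simp add: d_def \<mu>_def sum_subtractf n_def)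
  qed
  have dev: "(\<Sum>u\<in>P. x * \<bar>real (d s u) - \<mu> s\<bar>) \<le> card P * m" if s: "s \<in> S" for s
  proof -
    have "x * \<bar>real (d s u) - \<mu> s\<bar> \<le> 1 / 2 + (real (d s u) - \<mu> s)\<^sup>2 / (2 * n)" for u
      using sum_squares_bound[of "x * \<bar>real (d s u) - \<mu> s\<bar>" 1] x by (simp add: power_mult_distrib)
    then have "(\<Sum>u\<in>P. x * \<bar>real (d s u) - \<mu> s\<bar>) \<le> (\<Sum>u\<in>P. 1 / 2 + (real (d s u) - \<mu> s)\<^sup>2 / (2 * n))"
      by (rule sum_mono)
    also have "\<dots> = card P / 2 + (\<Sum>u\<in>P. (real (d s u) - \<mu> s)\<^sup>2) / (2 * n)"
      by (simp add: sum.distrib sum_divide_distrib)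
    also have "\<dots> \<le> card P / 2 + card P * (n * (real D)\<^sup>2) / (2 * n)"
      using var[OF s] by (intro add_left_mono divide_right_mono) auto
    also have "\<dots> = card P * m" using n by (simp add: m_def field_simps)
    finally show ?thesis .
  qed
  define g where "g u = (\<Sum>s\<in>S. x * \<bar>real (d s u) - \<mu> s\<bar>)" for u
  have "(\<Sum>u\<in>P. g u) = (\<Sum>s\<in>S. \<Sum>u\<in>P. x * \<bar>real (d s u) - \<mu> s\<bar>)"
    unfolding g_def by (rule sum.swap)
  also have "\<dots> \<le> (\<Sum>s\<in>S. card P * m)" by (intro sum_mono dev)
  also have "\<dots> = card P * (card S * m)" by simp
  finally have "card P * exp (- (card S * m)) \<le> (\<Sum>u\<in>P. exp (- g u))"
    by (rule sum_exp_ge)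
  also have "\<dots> \<le> (exp 3 / x) ^ card S"
  proof -
    define A where "A s = d s ` P" for s
    define w where "w s a = exp (- (x * \<bar>real a - \<mu> s\<bar>))" for s a
    let ?\<phi> = "\<lambda>u. \<lambda>s\<in>S. d s u"
    have A: "finite (A s)" for s using finP by (simp add: A_def)
    have "(\<Sum>u\<in>P. exp (- g u)) = (\<Sum>u\<in>P. \<Prod>s\<in>S. w s (?\<phi> u s))"
      using S by (simp add: g_def w_def exp_sum[symmetric] sum_negf)
    \<comment> \<open>Here the separation of tuples enters: the sum over tuples becomes a sum over
      distinct vectors of statistics.\<close>
    also have "\<dots> = (\<Sum>h\<in>?\<phi> ` P. \<Prod>s\<in>S. w s (h s))"
      using inj by (subst sum.reindex) (auto simp: P_def d_def)
    \<comment> \<open>Enlarging the image to a full box only adds nonnegative terms and makes the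
      sum factorise over \<open>S\<close>.\<close>
    also have "\<dots> \<le> (\<Sum>h\<in>Pi\<^sub>E S A. \<Prod>s\<in>S. w s (h s))"
      using A S by (intro sum_mono2) (auto simp: finite_PiE A_def w_def intro!: prod_nonneg)
    also have "\<dots> = (\<Prod>s\<in>S. \<Sum>a\<in>A s. w s a)"
      using S A by (intro prod_sum_PiE[symmetric]) auto
    also have "\<dots> \<le> (\<Prod>s\<in>S. exp 3 / x)"
      unfolding w_def using x A by (intro prod_mono conjI sum_nonneg sum_exp_abs_le) auto
    finally show ?thesis by simp
  qed
  finally have "card P * exp (- (card S * m)) * exp (card S * m) \<le> (exp 3 / x) ^ card S * exp (card S * m)"
    by (intro mult_right_mono) auto
  then have "card P \<le> (exp 3 / x) ^ card S * exp m ^ card S"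
    unfolding mult.assoc exp_add[symmetric] by (simp add: exp_of_nat_mult)
  also have "\<dots> = (exp (3 + m) * sqrt n) ^ card S"
    by (simp add: x_def power_mult_distrib exp_add mult_ac)
  finally show ?thesis using cardP by (simp add: n_def m_def)
qed

section \<open>The lower bound\<close>

text \<open>Connectedness ignores orientation, but the arcs are symmetric, so directed reachability
  follows.\<close>

lemma connected_pair_graph_rtrancl:
  assumes "pair_graph G" "Digraph_Component.connected (with_proj G)"
    and "x \<in> pverts G" "y \<in> pverts G"
  shows "(x, y) \<in> (parcs G)\<^sup>*"
proof -
  interpret pair_graph G by fact
  have "strongly_connected (with_proj G)"
    using symmetric_connected_imp_strongly_connected assms(2) pair_sym_arcs by blast
  then have "x \<rightarrow>\<^sup>*\<^bsub>with_proj G\<^esub> y"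
    using assms(3,4) by (auto simp: strongly_connected_def)
  from reachable_rtranclI[OF this] show ?thesis by simp
qed

lemma card_power_le_metric_dimension:
  assumes G: "pair_graph G" and conn: "Digraph_Component.connected (with_proj G)"
    and V: "pverts G \<noteq> {}"
  obtains c :: real where "c \<ge> 0"
    "\<And>n. n \<ge> 1 \<Longrightarrow> real (card (pverts G)) ^ n \<le> (exp c * sqrt n) ^ metric_dimension (cartesian_power G n)"
proof -
  interpret pair_graph G by (rule G)
  let ?V = "pverts G"
  let ?d = "rel_dist (parcs G)"
  \<comment> \<open>The diameter of \<open>G\<close>. The constant depends on it alone and hence not
    on \<open>n\<close>.\<close>
  define D where "D = Max ((\<lambda>(x, y). ?d x y) ` (?V \<times> ?V))"
  have D: "?d x y \<le> D" if "x \<in> ?V" "y \<in> ?V" for x y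
    unfolding D_def using that pair_finite_verts by (intro Max_ge) auto
  show thesis
  proof (rule that[of "3 + (1 + (real D)\<^sup>2) / 2"])
    fix n :: nat assume n: "n \<ge> 1"
    define H where "H = cartesian_power G n"
    have verts: "pverts H = {..<n} \<rightarrow>\<^sub>E ?V"
      by (simp add: H_def cartesian_power_def cartesian_product_def)
    have dist: "graph_dist H u s = ereal (real (\<Sum>i<n. ?d (u i) (s i)))"
      if "u \<in> pverts H" "s \<in> pverts H" for u s
      unfolding H_def cartesian_power_def
      using that G connected_pair_graph_rtrancl[OF G conn]
      by (intro graph_dist_cartesian_product) (auto simp: verts)
    have zero: "?d x y = 0 \<Longrightarrow> x = y" if "x \<in> ?V" "y \<in> ?V" for x y
      using rel_dist_relpow[OF connected_pair_graph_rtrancl[OF G conn that]] by simp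
    obtain S where S: "finite S" "resolves S H" "card S = metric_dimension H"
    proof (rule metric_dimension_witness)
      show "finite (pverts H)" using pair_finite_verts by (simp add: verts finite_PiE)
      show "u = v" if uv: "u \<in> pverts H" "v \<in> pverts H" "graph_dist H u v = graph_dist H v v" for u v
      proof -
        have "\<forall>i<n. ?d (u i) (v i) = 0" using uv(3) unfolding dist[OF uv(1,2)] dist[OF uv(2,2)] by (simp del: of_nat_sum)
        with uv(1,2) show ?thesis
          unfolding verts by (intro PiE_ext[of u _ _ v]) (auto intro!: zero)
      qed
    qed
    have SV: "s i \<in> ?V" if "s \<in> S" "i < n" for s i
      using S(2) that by (auto simp: resolves_def verts)
    have "real (card ?V) ^ card {..<n} \<le> (exp (3 + (1 + (real D)\<^sup>2) / 2) * sqrt (card {..<n})) ^ card S"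
    \<comment> \<open>The statistics are the distances to the vertices of \<open>S\<close>, split by
      coordinate; injectivity is exactly that \<open>S\<close> resolves \<open>H\<close>.\<close>
    proof (rule card_power_le_of_inj_sums[where c = "\<lambda>s i a. ?d a (s i)"])
      show "inj_on (\<lambda>u. \<lambda>s\<in>S. \<Sum>i<n. ?d (u i) (s i)) ({..<n} \<rightarrow>\<^sub>E ?V)"
        unfolding verts[symmetric]
      proof (rule inj_onI)
        fix u v assume uv: "u \<in> pverts H" "v \<in> pverts H"
          "(\<lambda>s\<in>S. \<Sum>i<n. ?d (u i) (s i)) = (\<lambda>s\<in>S. \<Sum>i<n. ?d (v i) (s i))"
        have "graph_dist H u s = graph_dist H v s" if "s \<in> S" for s
        proof -
          have "(\<Sum>i<n. ?d (u i) (s i)) = (\<Sum>i<n. ?d (v i) (s i))"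
            using fun_cong[OF uv(3), of s] that by simp
          moreover have "s \<in> pverts H" using S(2) that by (auto simp: resolves_def)
          ultimately show ?thesis using uv(1,2) by (simp only: dist)
        qed
        then show "u = v" using S(2) uv by (auto simp: resolves_def)
      qed
    qed (use n V pair_finite_verts S(1) D SV in \<open>auto simp: lessThan_empty_iff\<close>)
    then show "real (card ?V) ^ n \<le> (exp (3 + (1 + (real D)\<^sup>2) / 2) * sqrt n) ^ metric_dimension (cartesian_power G n)"
      using S(3) by (simp add: H_def)
  qed simp
qed

theorem theorem3p1:
  fixes G :: "'a pair_pre_digraph" and q :: nat
  assumes "pair_graph G"
    and "Digraph_Component.connected (with_proj G)"
    and "card (pverts G) = q"
    and "q \<ge> 2"
  shows "\<exists>e \<in> O(\<lambda>n::nat. ln (ln (real n)) / ln (real n)).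
           \<forall>n::nat. real (metric_dimension (cartesian_power G n))
                      \<ge> (2 - e n) * (real n / log (real q) (real n))"
proof -
  have "pverts G \<noteq> {}" using assms(3,4) by auto
  then obtain c where c: "c \<ge> 0" and
    le: "\<And>n. n \<ge> 1 \<Longrightarrow> real (card (pverts G)) ^ n \<le> (exp c * sqrt n) ^ metric_dimension (cartesian_power G n)"
    using card_power_le_metric_dimension[OF assms(1,2)] by metis
  \<comment> \<open>With \<open>L = ln n\<close> and \<open>y = n / log q n\<close>, taking
    logarithms gives \<open>k \<ge> 2 * y / (1 + 2 * c / L)\<close>, and
    \<open>1 / (1 + t) \<ge> 1 - t\<close> for \<open>t \<ge> 0\<close> yields the factor
    \<open>2 - 4 * c / L\<close>.\<close>
  define e where "e n = 4 * c / ln (real n)" for n :: nat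
  have "e \<in> O(\<lambda>n::nat. ln (ln (real n)) / ln (real n))"
  proof (rule bigoI)
    \<comment> \<open>Eventually \<open>ln (ln n) \<ge> 1\<close>, so a multiple of
      \<open>1 / ln n\<close> lies in the required class.\<close>
    have "filterlim (\<lambda>n. ln (ln (real n))) at_top sequentially"
      by (intro filterlim_compose[OF ln_at_top] filterlim_real_sequentially)
    then have "eventually (\<lambda>n. ln (ln (real n)) \<ge> 1) sequentially"
      by (simp add: filterlim_at_top)
    then show "eventually (\<lambda>n. norm (e n) \<le> 4 * c * norm (ln (ln (real n)) / ln (real n))) sequentially"
    proof eventually_elim
      case (elim n)
      then have "4 * c * 1 / \<bar>ln (real n)\<bar> \<le> 4 * c * ln (ln (real n)) / \<bar>ln (real n)\<bar>"
        using c by (intro divide_right_mono mult_left_mono) auto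
      then show ?case using c elim by (simp add: e_def abs_mult)
    qed
  qed
  moreover have "real (metric_dimension (cartesian_power G n)) \<ge> (2 - e n) * (real n / log (real q) (real n))"
    for n :: nat
  proof (cases "n \<ge> 2")
    case False
    then have "n = 0 \<or> n = 1" by auto
    \<comment> \<open>The right-hand side is 0: for \<open>n = 0\<close> by its numerator, for
      \<open>n = 1\<close> because the logarithm is 0 and division by 0 gives 0.\<close>
    then show ?thesis by (auto simp: log_def)
  next
    case True
    define k where "k = real (metric_dimension (cartesian_power G n))"
    define L where "L = ln (real n)"
    define y where "y = real n * ln (real q) / L"
    have L: "L > 0" using True by (simp add: L_def)
    have y: "y \<ge> 0" using L assms(4) by (simp add: y_def)
    have "ln (real q ^ n) \<le> ln ((exp c * sqrt n) ^ metric_dimension (cartesian_power G n))"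
      using le[of n] True assms(3,4) by (intro ln_mono) auto
    then have "real n * ln (real q) \<le> k * (c + L / 2)"
      using True assms(4) by (simp add: ln_realpow ln_mult ln_sqrt k_def L_def)
    then have yk: "y * L \<le> k * (c + L / 2)" using L by (simp add: y_def)
    have "(2 - 4 * c / L) * y \<le> k"
    \<comment> \<open>The bound \<open>yk\<close> can be multiplied by this factor only if it is
      nonnegative; otherwise the claim is trivial.\<close>
    proof (cases "2 - 4 * c / L \<ge> 0")
      case False
      then have "(2 - 4 * c / L) * y \<le> 0" using y by (intro mult_nonpos_nonneg) auto
      then show ?thesis by (simp add: k_def)
    next
      case t: True
      have "(2 - 4 * c / L) * y * L\<^sup>2 = (2 - 4 * c / L) * L * (y * L)"
        by (simp add: power2_eq_square)
      also have "\<dots> \<le> (2 - 4 * c / L) * L * (k * (c + L / 2))"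
        using t L yk by (intro mult_left_mono) auto
      \<comment> \<open>A difference of squares:
        \<open>(2 * L - 4 * c) * (c + L / 2) = (L - 2 * c) * (L + 2 * c)\<close>.\<close>
      also have "\<dots> = k * (L\<^sup>2 - 4 * c\<^sup>2)"
        using L by (simp add: field_simps power2_eq_square)
      also have "\<dots> \<le> k * L\<^sup>2" by (intro mult_left_mono) (auto simp: k_def)
      finally show ?thesis using L by simp
    qed
    moreover have "real n / log (real q) (real n) = y" by (simp add: log_def y_def L_def)
    ultimately show ?thesis by (simp add: e_def k_def L_def)
  qed
  ultimately show ?thesis by blast
qed

end
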